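(* Let $M$ be a finite set of prime numbers. The number of $M$-primes in $P_M$ is $\prod_{p_i\in M}(p_i-1)$.
   Context: For a set $M$ of prime numbers, an $M$-prime is an integer not divisible by any of the primes in $M$. $P_M=\{x\in\mathbb{Z}: 0\le x<\prod_{p_i\in M}p_i\}$. *)

theory Defs
  imports Main "HOL-Computational_Algebra.Primes"
begin

(* On type int, the library predicate prime holds only for positive (normalized) primes,
   so sets of primes are represented as sets of integers without coercions. *)

definition M_prime :: "int set \<Rightarrow> int \<Rightarrow> bool" where
  "M_prime M x \<longleftrightarrow> (\<forall>p\<in>M. \<not> p dvd x)"

definition P_set :: "int set \<Rightarrow> int set" where
  "P_set M = {x. 0 \<le> x \<and> x < (\<Prod>p\<in>M. p)}"

end

(* For N the product of the primes in M, an M-prime is an integer coprime to N, so the count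
   is Euler's totient of N, which is multiplicative. The empty M is separate: there N = 1,
   and the library represents the residues coprime to N in (0, N] rather than in [0, N). *)

theory Submission
  imports Defs "HOL-Number_Theory.Totient"
begin

text \<open>A prime that does not divide \<open>x\<close> is coprime to \<open>x\<close>, and
  coprimality to each factor passes to the product. Conversely, a prime of \<open>M\<close> dividing
  \<open>x\<close> would be a non-unit common divisor of \<open>x\<close> and the product.\<close>

lemma coprime_prod_primes_iff:
  fixes M :: "int set"
  assumes "finite M" and "\<And>p. p \<in> M \<Longrightarrow> prime p"
  shows "coprime x (\<Prod>M) \<longleftrightarrow> M_prime M x"
proof
  assume "M_prime M x"
  then have "coprime x p" if "p \<in> M" for p
    using that assms(2)[OF that] prime_imp_coprime[of p x]
    by (simp add: M_prime_def coprime_commute)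
  then show "coprime x (\<Prod>M)"
    by (intro prod_coprime_right)
next
  assume co: "coprime x (\<Prod>M)"
  have "\<not> p dvd x" if "p \<in> M" for p
  proof -
    from that assms(1) have "p dvd \<Prod>M" by auto
    then show ?thesis
      using coprime_common_divisor[OF co, of p] assms(2)[OF that] not_prime_unit by blast
  qed
  then show "M_prime M x" by (simp add: M_prime_def)
qed

text \<open>Induction on \<open>M\<close>: a new prime \<open>p\<close> is coprime to the product of
  the others, so it contributes the factor \<open>totient (nat p)\<close>, which is p - 1.\<close>

lemma totient_prod_primes:
  fixes M :: "int set"
  assumes "finite M" and "\<And>p. p \<in> M \<Longrightarrow> prime p"
  shows "int (totient (nat (\<Prod>M))) = (\<Prod>p\<in>M. p - 1)"
  using assms
proof (induction M)
  case empty
  then show ?case by simp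
next
  case (insert p M)
  have p: "prime p" "prime (nat p)" "p > 1"
    using insert.prems[of p] prime_gt_1_int[of p] by simp_all
  have M: "prime q" if "q \<in> M" for q
    using that insert.prems by blast
  then have pos: "\<Prod>M > 0"
    by (intro prod_pos) (simp add: prime_gt_0_int)
  have "coprime p q" if "q \<in> M" for q
    using that M insert.hyps(2) p(1) by (intro primes_coprime) auto
  then have "coprime p (\<Prod>M)" by (intro prod_coprime_right)
  then have "coprime (nat p) (nat (\<Prod>M))"
    using p pos by (simp flip: coprime_int_iff)
  moreover have "nat (\<Prod>(insert p M)) = nat p * nat (\<Prod>M)"
    using insert.hyps p by (simp add: nat_mult_distrib)
  ultimately have "totient (nat (\<Prod>(insert p M))) = (nat p - 1) * totient (nat (\<Prod>M))"
    using p by (simp only: totient_mult_coprime totient_prime)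
  \<comment> \<open>Since p > 1, the truncated subtraction in \<open>nat p - 1\<close> agrees with
    integer subtraction.\<close>
  then have "int (totient (nat (\<Prod>(insert p M)))) = (p - 1) * int (totient (nat (\<Prod>M)))"
    using p(3) by simp
  also have "int (totient (nat (\<Prod>M))) = (\<Prod>q\<in>M. q - 1)"
    using M by (rule insert.IH)
  finally show ?case
    using insert.hyps by simp
qed

theorem mainTheorem9:
  fixes M :: "int set"
  assumes "finite M" and "\<And>p. p \<in> M \<Longrightarrow> prime p"
  shows "int (card {x \<in> P_set M. M_prime M x}) = (\<Prod>p\<in>M. p - 1)"
proof (cases "M = {}")
  case True
  \<comment> \<open>The empty product is 1, so only 0 is in range, and it is vacuously an M-prime;
    both sides of the claim are 1.\<close>
  then have "{x \<in> P_set M. M_prime M x} = {0}"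
    by (auto simp: P_set_def M_prime_def)
  then show ?thesis using True by simp
next
  case False
  define N where "N = nat (\<Prod>M)"
  have "1 < \<Prod>M"
    using assms False by (intro less_1_prod) (auto simp: prime_gt_1_int)
  then have N: "N > 1" "int N = \<Prod>M" by (auto simp: N_def)
  have "{x \<in> P_set M. M_prime M x} = {x. 0 \<le> x \<and> x < int N \<and> coprime x (int N)}"
    using coprime_prod_primes_iff[OF assms] N by (auto simp: P_set_def)
  also have "\<dots> = int ` totatives N"
  proof (intro equalityI subsetI)
    fix x assume x: "x \<in> {x. 0 \<le> x \<and> x < int N \<and> coprime x (int N)}"
    then obtain k where k: "x = int k" by (auto elim: nonneg_int_cases)
    \<comment> \<open>0 is coprime only to units, and N > 1.\<close>
    with x N have "k \<noteq> 0" by (auto intro!: Nat.gr0I)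
    with x k show "x \<in> int ` totatives N"
      by (auto simp: totatives_def)
  next
    fix x assume "x \<in> int ` totatives N"
    then obtain k where "x = int k" "k \<in> totatives N" by blast
    then show "x \<in> {x. 0 \<le> x \<and> x < int N \<and> coprime x (int N)}"
      \<comment> \<open>For N > 1 the endpoint N is not coprime to itself, so totatives are strictly
        below N.\<close>
      using N(1) totatives_less[of k N] by (simp add: in_totatives_iff)
  qed
  finally have "card {x \<in> P_set M. M_prime M x} = totient N"
    by (simp add: card_image totient_def)
  then show ?thesis
    using totient_prod_primes[OF assms] by (simp add: N_def)
qed

end
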